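(* For all integers $n\ge 1$ and $s\ge 1$, $$\sum_{j=0}^{s-1}\binom{n+j}{j}f_{n,s-j-1}=\sum_{j=0}^{\lfloor n/2\rfloor}(-1)^j\binom{\binom{s+1}{2}+j-1}{j}\binom{s}{n-2j}.$$
   Context: Let $S_n$ be the symmetric group on $[n]=\{1,\dots,n\}$ and $\mathscr{I}_n\subseteq S_n$ the set of involutions, i.e. permutations $\sigma$ with $\sigma^2=\mathrm{id}$ (the identity included). For $\sigma\in S_n$, $\mathrm{ris}(\sigma)$ is the number of rises of $\sigma$, i.e. the number of $i\in\{1,\dots,n-1\}$ with $\sigma(i)<\sigma(i+1)$, and $\mathrm{sgn}(\sigma)\in\{1,-1\}$ is the sign of $\sigma$. The signed Eulerian numbers on involutions $f_{n,k}$ are defined by $$F_n(t)=\sum_{\sigma\in\mathscr{I}_n}\mathrm{sgn}(\sigma)\,t^{\mathrm{ris}(\sigma)}=\sum_{k=0}^{n-1}f_{n,k}t^k ,$$ and $f_{n,k}=0$ for $k\ge n$. Convention: $\binom{a}{b}=0$ for integers $b>a\ge0$. *)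

theory Defs
  imports "HOL-Combinatorics.Permutations" "HOL-Computational_Algebra.Polynomial"
begin

definition involutions :: "nat \<Rightarrow> (nat \<Rightarrow> nat) set" where
  "involutions n = {\<sigma>. \<sigma> permutes {1..n} \<and> \<sigma> \<circ> \<sigma> = id}"

definition ris :: "nat \<Rightarrow> (nat \<Rightarrow> nat) \<Rightarrow> nat" where
  "ris n \<sigma> = card {i \<in> {1..n - 1}. \<sigma> i < \<sigma> (i + 1)}"

definition signed_eulerian_inv_poly :: "nat \<Rightarrow> int poly" where
  "signed_eulerian_inv_poly n = (\<Sum>\<sigma>\<in>involutions n. monom (sign \<sigma>) (ris n \<sigma>))"

definition signed_eulerian_inv :: "nat \<Rightarrow> nat \<Rightarrow> int" where
  "signed_eulerian_inv n k = coeff (signed_eulerian_inv_poly n) k"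

lemma ris_le: "ris n \<sigma> \<le> n - 1"
proof -
  have "ris n \<sigma> \<le> card {1..n - 1}"
    unfolding ris_def by (rule card_mono) auto
  then show ?thesis by simp
qed

lemma signed_eulerian_inv_eq_0:
  assumes "n \<ge> 1" "k \<ge> n"
  shows "signed_eulerian_inv n k = 0"
proof -
  have "ris n \<sigma> \<noteq> k" for \<sigma>
    using ris_le[of n \<sigma>] assms by linarith
  then show ?thesis
    by (simp add: signed_eulerian_inv_def signed_eulerian_inv_poly_def coeff_sum)
qed

end

theory Submission
  imports Defs "HOL-Library.Product_Lexorder"
begin

text \<open>
  Both sides count symmetric \<open>s \<times> s\<close> matrices of natural numbers with entry sum \<open>n\<close>, with sign.

  On the left, \<open>(n + s - 1 - ris \<sigma>) choose n\<close> is the number of weakly increasing colourings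
  \<open>c 1 \<le> \<dots> \<le> c n\<close> of the positions by \<open>1, \<dots>, s\<close> that are strict at every rise of \<open>\<sigma>\<close>
  (\<open>card_colourings\<close>), so the left side is the sum of \<open>sign \<sigma>\<close> over all pairs of an involution \<open>\<sigma>\<close>
  and such a colouring (\<open>sum_coeffs_eq_sum_coloured_involutions\<close>). Compatibility means that \<open>c\<close> is
  weakly increasing and \<open>\<sigma>\<close> is decreasing on every colour block.

  Send such a pair to the matrix \<open>M\<close> whose entry at \<open>(a, b)\<close> is the number of positions \<open>i\<close> with
  \<open>c i = a\<close> and \<open>c (\<sigma> i) = b\<close>. It is symmetric because \<open>\<sigma>\<close> is an involution, and the map is a
  bijection (\<open>bij_betw_colour_pairs\<close>): since \<open>\<sigma>\<close> and its inverse are decreasing on blocks,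
  the order in which the pairs \<open>(c i, c (\<sigma> i))\<close> occur is forced, and so is \<open>\<sigma>\<close>. This plays the
  part that the Robinson-Schensted-Knuth correspondence has in proofs by symmetric functions.

  Each block contains at most one fixed point of \<open>\<sigma>\<close>, and it contains one exactly if the diagonal entry of
  the block is odd (\<open>card_fixed_points\<close>). Hence \<open>sign \<sigma> = (- 1) ^ ((n - d) div 2)\<close>, where \<open>d\<close> is the number of odd
  diagonal entries of \<open>M\<close> (\<open>sign_eq_odd_diagonal\<close>).

  A symmetric matrix is the same as a set \<open>D\<close> of odd diagonal places together with a multiset \<open>N\<close>
  on the \<open>(s + 1) choose 2\<close> places on or above the diagonal, with \<open>n = 2 * size N + card D\<close>
  (\<open>bij_betw_symmetrize\<close>). The sign is \<open>(- 1) ^ size N\<close>, and counting the choices of \<open>N\<close> and \<open>D\<close> with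
  \<open>size N = j\<close> gives the right side (\<open>sum_symmetric_msets\<close>).
\<close>

section \<open>Counting compatible colourings\<close>

text \<open>
  Words \<open>c 1 \<le> \<dots> \<le> c n\<close> in the letters \<open>1, \<dots>, s\<close> that increase strictly at the positions
  in \<open>A\<close>. The value \<open>0\<close> outside \<open>{1..n}\<close> makes the function determined by the word.
\<close>
definition colourings :: "nat \<Rightarrow> nat \<Rightarrow> nat set \<Rightarrow> (nat \<Rightarrow> nat) set" where
  "colourings n s A = {c. c ` {1..n} \<subseteq> {1..s} \<and> (\<forall>i. i \<notin> {1..n} \<longrightarrow> c i = 0) \<and>
     (\<forall>i\<in>{1..<n}. c i + of_bool (i \<in> A) \<le> c (Suc i))}"

lemma finite_colourings: "finite (colourings n s A)"
proof (rule finite_subset)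
  show "colourings n s A \<subseteq> {c. \<forall>i. (i \<in> {1..n} \<longrightarrow> c i \<in> {1..s}) \<and> (i \<notin> {1..n} \<longrightarrow> c i = 0)}"
    unfolding colourings_def by blast
  show "finite {c. \<forall>i. (i \<in> {1..n} \<longrightarrow> c i \<in> {1..s}) \<and> (i \<notin> {1..n} \<longrightarrow> c i = (0::nat))}"
    by (rule finite_set_of_finite_funs) auto
qed

lemma colouringsI:
  assumes "\<And>i. 1 \<le> i \<Longrightarrow> i \<le> n \<Longrightarrow> 1 \<le> c i \<and> c i \<le> s"
    and "\<And>i. i < 1 \<or> n < i \<Longrightarrow> c i = 0"
    and "\<And>i. 1 \<le> i \<Longrightarrow> i < n \<Longrightarrow> c i + of_bool (i \<in> A) \<le> c (Suc i)"
  shows "c \<in> colourings n s A"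
  unfolding colourings_def
proof (intro CollectI conjI allI impI ballI)
  show "c ` {1..n} \<subseteq> {1..s}"
    using assms(1) by auto
  show "c i = 0" if "i \<notin> {1..n}" for i
    using assms(2)[of i] that by auto
  show "c i + of_bool (i \<in> A) \<le> c (Suc i)" if "i \<in> {1..<n}" for i
    using assms(3)[of i] that by auto
qed

lemma colouringsD:
  assumes "c \<in> colourings n s A"
  shows "1 \<le> i \<Longrightarrow> i \<le> n \<Longrightarrow> 1 \<le> c i"
    and "1 \<le> i \<Longrightarrow> i \<le> n \<Longrightarrow> c i \<le> s"
    and "i < 1 \<or> n < i \<Longrightarrow> c i = 0"
    and "1 \<le> i \<Longrightarrow> i < n \<Longrightarrow> c i + of_bool (i \<in> A) \<le> c (Suc i)"
  using assms unfolding colourings_def by (force simp: image_subset_iff)+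

lemma colourings_mono:
  assumes c: "c \<in> colourings n s A" and "1 \<le> i" "i \<le> j" "j \<le> n"
  shows "c i \<le> c j"
  using assms(3,2,4)
proof (induction rule: inc_induct)
  case (step m)
  then show ?case using colouringsD(4)[OF c, of m] by linarith
qed simp

lemma colourings_last_less:
  assumes "s \<ge> 1"
  shows "{c \<in> colourings (Suc n) s A. c (Suc n) \<noteq> s} = colourings (Suc n) (s - 1) A"
proof (intro equalityI subsetI)
  fix c assume "c \<in> {c \<in> colourings (Suc n) s A. c (Suc n) \<noteq> s}"
  then have c: "c \<in> colourings (Suc n) s A" and last: "c (Suc n) \<noteq> s"
    by auto
  have "c i \<le> s - 1" if "1 \<le> i" "i \<le> Suc n" for i
    using colourings_mono[OF c that(1) that(2)] colouringsD(2)[OF c, of "Suc n"] last by auto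
  then show "c \<in> colourings (Suc n) (s - 1) A"
    using colouringsD[OF c] by (intro colouringsI) auto
next
  fix c assume c: "c \<in> colourings (Suc n) (s - 1) A"
  have "c (Suc n) \<noteq> s"
    using colouringsD(2)[OF c, of "Suc n"] assms by auto
  moreover have "c \<in> colourings (Suc n) s A"
  proof (rule colouringsI)
    show "1 \<le> c i \<and> c i \<le> s" if "1 \<le> i" "i \<le> Suc n" for i
      using colouringsD(1,2)[OF c that] by simp
  qed (use colouringsD(3,4)[OF c] in auto)
  ultimately show "c \<in> {c \<in> colourings (Suc n) s A. c (Suc n) \<noteq> s}"
    by simp
qed

lemma colourings_last_eq:
  assumes "s \<ge> 1"
  shows "bij_betw (\<lambda>c. c(Suc n := s)) (colourings n (s - of_bool (n \<in> A \<and> n \<ge> 1)) A)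
           {c \<in> colourings (Suc n) s A. c (Suc n) = s}"
proof (rule bij_betwI[where g = "\<lambda>c. c(Suc n := 0)"])
  let ?t = "s - of_bool (n \<in> A \<and> n \<ge> 1)"
  show "(\<lambda>c. c(Suc n := s)) \<in> colourings n ?t A \<rightarrow> {c \<in> colourings (Suc n) s A. c (Suc n) = s}"
  proof
    fix c assume c: "c \<in> colourings n ?t A"
    have last: "c n + of_bool (n \<in> A) \<le> s" if "1 \<le> n"
      using colouringsD(2)[OF c, of n] that assms by (auto split: if_splits)
    have "c(Suc n := s) \<in> colourings (Suc n) s A"
    proof (rule colouringsI)
      fix i assume i: "1 \<le> i" "i \<le> Suc n"
      have "1 \<le> c i \<and> c i \<le> ?t" if "i \<le> n"
        using colouringsD(1,2)[OF c i(1) that] by simp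
      then show "1 \<le> (c(Suc n := s)) i \<and> (c(Suc n := s)) i \<le> s"
        using i(2) assms by (cases "i = Suc n") (simp, force)
    next
      fix i assume "i < 1 \<or> Suc n < i"
      then show "(c(Suc n := s)) i = 0"
        using colouringsD(3)[OF c, of i] by auto
    next
      fix i assume "1 \<le> i" "i < Suc n"
      then show "(c(Suc n := s)) i + of_bool (i \<in> A) \<le> (c(Suc n := s)) (Suc i)"
        using colouringsD(4)[OF c, of i] last by (cases "i = n") auto
    qed
    then show "c(Suc n := s) \<in> {c \<in> colourings (Suc n) s A. c (Suc n) = s}"
      by simp
  qed
  show "(\<lambda>c. c(Suc n := 0)) \<in> {c \<in> colourings (Suc n) s A. c (Suc n) = s} \<rightarrow> colourings n ?t A"
  proof
    fix c assume "c \<in> {c \<in> colourings (Suc n) s A. c (Suc n) = s}"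
    then have c: "c \<in> colourings (Suc n) s A" and eq: "c (Suc n) = s"
      by auto
    have "c i \<le> ?t" if "1 \<le> i" "i \<le> n" for i
      using colourings_mono[OF c that(1,2)] colouringsD(4)[OF c, of n] eq that by auto
    then show "c(Suc n := 0) \<in> colourings n ?t A"
      using colouringsD(1,3,4)[OF c] by (intro colouringsI) auto
  qed
next
  fix c assume "c \<in> colourings n (s - of_bool (n \<in> A \<and> n \<ge> 1)) A"
  then show "(c(Suc n := s))(Suc n := 0) = c"
    by (auto simp: colouringsD(3) fun_eq_iff)
next
  fix c assume "c \<in> {c \<in> colourings (Suc n) s A. c (Suc n) = s}"
  then show "(c(Suc n := 0))(Suc n := s) = c"
    by auto
qed

text \<open>
  Splitting by whether the last letter is \<open>s\<close> gives Pascal's recursion. If it is \<open>s\<close>, the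
  shorter word uses the letters up to \<open>s\<close>, or up to \<open>s - 1\<close> when \<open>A\<close> forces a strict step there;
  that loss of a letter cancels the loss of a strict position in the upper index of the binomial.
  Truncated subtraction makes the formula give the correct count \<open>0\<close> when \<open>n > 0\<close> and \<open>A\<close>
  requires \<open>s\<close> or more strict steps.
\<close>
lemma card_colourings:
  "card (colourings n s A) = (n + s - 1 - card ({1..<n} \<inter> A)) choose n"
proof (induction "n + s" arbitrary: n s rule: less_induct)
  case less
  show ?case
  proof (cases n)
    case 0
    then have "colourings n s A = {\<lambda>_. 0}"
      by (auto simp: colourings_def)
    then show ?thesis using 0 by simp
  next
    case (Suc m)
    show ?thesis
    proof (cases "s = 0")
      case True
      then have "colourings n s A = {}"
        using Suc by (auto simp: colourings_def)
      then show ?thesis using Suc True by (simp add: binomial_eq_0)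
    next
      case False
      let ?b = "of_bool (m \<in> A \<and> m \<ge> 1) :: nat"
      let ?r = "card ({1..<n} \<inter> A)" and ?r' = "card ({1..<m} \<inter> A)"
      have r: "?r = ?r' + ?b"
      proof -
        have "{1..<n} \<inter> A = (if m \<in> A \<and> m \<ge> 1 then insert m ({1..<m} \<inter> A) else {1..<m} \<inter> A)"
          using Suc by (auto simp: less_Suc_eq)
        then show ?thesis by simp
      qed
      have r'_le: "?r' \<le> m - 1"
        using card_mono[of "{1..<m}" "{1..<m} \<inter> A"] by auto
      have "card (colourings n s A) =
          card {c \<in> colourings n s A. c n \<noteq> s} + card {c \<in> colourings n s A. c n = s}"
        using finite_colourings
        by (subst card_Un_disjoint[symmetric]) (auto intro!: arg_cong[where f = card])
      also have "card {c \<in> colourings n s A. c n \<noteq> s} = card (colourings n (s - 1) A)"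
        using colourings_last_less[of s m A] False Suc by simp
      also have "card {c \<in> colourings n s A. c n = s} = card (colourings m (s - ?b) A)"
        using bij_betw_same_card[OF colourings_last_eq[of s m A]] False Suc by simp
      also have "card (colourings n (s - 1) A) = (n + (s - 1) - 1 - ?r) choose n"
        by (rule less) (use False in simp)
      also have "card (colourings m (s - ?b) A) = (m + (s - ?b) - 1 - ?r') choose m"
        by (rule less) (use False Suc in simp)
      also have "m + (s - ?b) - 1 - ?r' = m + s - 1 - ?r"
        using False r by auto
      also have "n + (s - 1) - 1 - ?r = m + s - 1 - ?r"
        using False Suc by simp
      also have "((m + s - 1 - ?r) choose n) + ((m + s - 1 - ?r) choose m) = (n + s - 1 - ?r) choose n"
      proof -
        have "n + s - 1 - ?r = Suc (m + s - 1 - ?r)"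
          using False Suc r r'_le by (cases "m = 0") auto
        then show ?thesis using Suc by simp
      qed
      finally show ?thesis .
    qed
  qed
qed

section \<open>Colourings attached to involutions\<close>

lemma finite_involutions: "finite (involutions n)"
  unfolding involutions_def
  by (rule finite_subset[OF _ finite_permutations[of "{1..n}"]]) auto

definition rises :: "(nat \<Rightarrow> nat) \<Rightarrow> nat set" where
  "rises \<sigma> = {i. \<sigma> i < \<sigma> (Suc i)}"

definition coloured_involutions :: "nat \<Rightarrow> nat \<Rightarrow> ((nat \<Rightarrow> nat) \<times> (nat \<Rightarrow> nat)) set" where
  "coloured_involutions n s = (SIGMA \<sigma>:involutions n. colourings n s (rises \<sigma>))"

text \<open>
  A fixed involution contributes the single term \<open>j = s - 1 - ris n \<sigma>\<close>, whose binomial coefficient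
  is the number of its compatible colourings; if \<open>ris n \<sigma> \<ge> s\<close>, no term occurs and no colouring exists.
\<close>
lemma sum_coeffs_eq_sum_coloured_involutions:
  assumes "n \<ge> 1" "s \<ge> 1"
  shows "(\<Sum>j = 0..s - 1. int ((n + j) choose j) * signed_eulerian_inv n (s - j - 1)) =
    (\<Sum>(\<sigma>, c)\<in>coloured_involutions n s. sign \<sigma>)"
proof -
  have coef: "signed_eulerian_inv n k = (\<Sum>\<sigma>\<in>involutions n. if ris n \<sigma> = k then sign \<sigma> else 0)" for k
    by (simp add: signed_eulerian_inv_def signed_eulerian_inv_poly_def coeff_sum)
  have inner: "(\<Sum>j = 0..s - 1. if ris n \<sigma> = s - j - 1 then int ((n + j) choose j) * sign \<sigma> else 0) =
      int (card (colourings n s (rises \<sigma>))) * sign \<sigma>" for \<sigma>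
  proof -
    have eq: "{1..<n} \<inter> rises \<sigma> = {i \<in> {1..n - 1}. \<sigma> i < \<sigma> (i + 1)}"
      by (auto simp: rises_def)
    have C: "card (colourings n s (rises \<sigma>)) = (n + s - 1 - ris n \<sigma>) choose n"
      by (simp only: card_colourings ris_def eq)
    show ?thesis
    proof (cases "ris n \<sigma> \<le> s - 1")
      case True
      have "(\<Sum>j = 0..s - 1. if ris n \<sigma> = s - j - 1 then int ((n + j) choose j) * sign \<sigma> else 0) =
          (\<Sum>j = 0..s - 1. if j = s - 1 - ris n \<sigma> then int ((n + j) choose j) * sign \<sigma> else 0)"
        using True assms by (intro sum.cong) auto
      also have "\<dots> = int ((n + (s - 1 - ris n \<sigma>)) choose (s - 1 - ris n \<sigma>)) * sign \<sigma>"
        by simp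
      also have "(n + (s - 1 - ris n \<sigma>)) choose (s - 1 - ris n \<sigma>) = (n + s - 1 - ris n \<sigma>) choose n"
        using True assms by (subst binomial_symmetric) auto
      finally show ?thesis by (simp add: C)
    next
      case False
      then have "(n + s - 1 - ris n \<sigma>) choose n = 0"
        using assms by (intro binomial_eq_0) auto
      moreover have "(\<Sum>j = 0..s - 1. if ris n \<sigma> = s - j - 1 then int ((n + j) choose j) * sign \<sigma> else 0) = 0"
        using False by (intro sum.neutral) auto
      ultimately show ?thesis by (simp add: C)
    qed
  qed
  have "(\<Sum>j = 0..s - 1. int ((n + j) choose j) * signed_eulerian_inv n (s - j - 1)) =
    (\<Sum>j = 0..s - 1. \<Sum>\<sigma>\<in>involutions n. if ris n \<sigma> = s - j - 1 then int ((n + j) choose j) * sign \<sigma> else 0)"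
    unfolding coef sum_distrib_left by (intro sum.cong) auto
  also have "\<dots> = (\<Sum>\<sigma>\<in>involutions n. int (card (colourings n s (rises \<sigma>))) * sign \<sigma>)"
    by (subst sum.swap) (simp only: inner)
  also have "\<dots> = (\<Sum>(\<sigma>, c)\<in>coloured_involutions n s. sign \<sigma>)"
    unfolding coloured_involutions_def
    using finite_involutions finite_colourings by (subst sum.Sigma[symmetric]) auto
  finally show ?thesis .
qed

lemma involutionsD:
  assumes "\<sigma> \<in> involutions n"
  shows "\<sigma> permutes {1..n}" and "\<sigma> (\<sigma> i) = i"
  using assms by (auto simp: involutions_def fun_eq_iff)

text \<open>
  The colouring is constant between \<open>i\<close> and \<open>j\<close>, so none of \<open>i, \<dots>, j - 1\<close> is a rise.
\<close>
lemma decreasing_on_blocks: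
  assumes \<sigma>: "\<sigma> permutes {1..n}" and c: "c \<in> colourings n s (rises \<sigma>)"
    and "1 \<le> i" "i < j" "j \<le> n" "c i = c j"
  shows "\<sigma> j < \<sigma> i"
  using assms(4-6)
proof (induction j)
  case (Suc j)
  have j: "1 \<le> j" "j < n"
    using Suc.prems \<open>1 \<le> i\<close> by auto
  have "c i \<le> c j" "c j \<le> c (Suc j)"
    using Suc.prems(1,2) \<open>1 \<le> i\<close> j by (simp_all add: colourings_mono[OF c])
  then have same: "c j = c (Suc j)" "c i = c j"
    using Suc.prems(3) by linarith+
  then have "j \<notin> rises \<sigma>"
    using colouringsD(4)[OF c j] by (cases "j \<in> rises \<sigma>") simp_all
  moreover have "\<sigma> j \<noteq> \<sigma> (Suc j)"
    using inj_eq[OF permutes_inj[OF \<sigma>]] by simp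
  ultimately have "\<sigma> (Suc j) < \<sigma> j"
    by (simp add: rises_def)
  moreover have "\<sigma> j < \<sigma> i" if "i \<noteq> j"
    using that Suc.prems(1) j(2) same(2) by (intro Suc.IH) linarith+
  ultimately show ?case
    by (cases "i = j") simp_all
qed simp

text \<open>
  The relative order of the values of \<open>\<sigma>\<close> can be read off the colours of these values: between
  different colours it is the order of the colours, and inside a block it is reversed because
  \<open>\<sigma>\<close>, being its own inverse, is decreasing on the block that contains \<open>\<sigma> i\<close> and \<open>\<sigma> j\<close>.
\<close>
lemma coloured_involution_less_iff:
  assumes \<sigma>: "\<sigma> \<in> involutions n" and c: "c \<in> colourings n s (rises \<sigma>)"
    and i: "i \<in> {1..n}" and j: "j \<in> {1..n}"
  shows "\<sigma> i < \<sigma> j \<longleftrightarrow> c (\<sigma> i) < c (\<sigma> j) \<or> c (\<sigma> i) = c (\<sigma> j) \<and> j < i"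
proof -
  note perm = involutionsD(1)[OF \<sigma>] and inv = involutionsD(2)[OF \<sigma>]
  have *: "c (\<sigma> a) \<le> c (\<sigma> b) \<and> (c (\<sigma> a) = c (\<sigma> b) \<longrightarrow> b < a)"
    if "\<sigma> a < \<sigma> b" "a \<in> {1..n}" "b \<in> {1..n}" for a b
  proof -
    have "\<sigma> a \<in> {1..n}" "\<sigma> b \<in> {1..n}"
      using that permutes_in_image[OF perm] by auto
    then show ?thesis
      using colourings_mono[OF c, of "\<sigma> a" "\<sigma> b"] that
        decreasing_on_blocks[OF perm c, of "\<sigma> a" "\<sigma> b"] by (auto simp: inv)
  qed
  have "i = j" if "\<sigma> i = \<sigma> j"
    using that inv by metis
  then show ?thesis
    using *[of i j] *[of j i] i j by (cases "\<sigma> i" "\<sigma> j" rule: linorder_cases) auto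
qed

text \<open>
  A permutation is recovered from the order of its values as \<open>\<sigma> i = rank of \<sigma> i\<close>.
\<close>
lemma permutation_determined_by_order:
  fixes \<sigma> \<tau> :: "nat \<Rightarrow> nat"
  assumes \<sigma>: "\<sigma> permutes {1..n}" and \<tau>: "\<tau> permutes {1..n}"
    and iff: "\<And>i j. i \<in> {1..n} \<Longrightarrow> j \<in> {1..n} \<Longrightarrow> \<sigma> i < \<sigma> j \<longleftrightarrow> \<tau> i < \<tau> j"
  shows "\<sigma> = \<tau>"
proof
  have rank: "\<pi> i = Suc (card {j \<in> {1..n}. \<pi> j < \<pi> i})"
    if "\<pi> permutes {1..n}" "i \<in> {1..n}" for \<pi> :: "nat \<Rightarrow> nat" and i
  proof -
    have "\<pi> ` {j \<in> {1..n}. \<pi> j < \<pi> i} = {k \<in> \<pi> ` {1..n}. k < \<pi> i}"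
      by auto
    also have "\<dots> = {1..<\<pi> i}"
      using permutes_image[OF that(1)] permutes_in_image[OF that(1), of i] that(2) by auto
    finally have "card {j \<in> {1..n}. \<pi> j < \<pi> i} = card {1..<\<pi> i}"
      using card_image[of \<pi> "{j \<in> {1..n}. \<pi> j < \<pi> i}"] permutes_inj_on[OF that(1)] by metis
    then show ?thesis
      using permutes_in_image[OF that(1), of i] that(2) by simp
  qed
  fix i show "\<sigma> i = \<tau> i"
  proof (cases "i \<in> {1..n}")
    case True
    then have "{j \<in> {1..n}. \<sigma> j < \<sigma> i} = {j \<in> {1..n}. \<tau> j < \<tau> i}"
      using iff by blast
    then show ?thesis
      using rank[OF \<sigma> True] rank[OF \<tau> True] by simp
  qed (use \<sigma> \<tau> in \<open>auto simp: permutes_def\<close>)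
qed

section \<open>Coloured involutions and symmetric matrices\<close>

text \<open>
  A multiset of pairs stands for the \<open>s \<times> s\<close> matrix of its multiplicities; invariance under
  swapping says that the matrix is symmetric, and its size is the sum of all entries.
\<close>
definition symmetric_msets :: "nat \<Rightarrow> nat \<Rightarrow> (nat \<times> nat) multiset set" where
  "symmetric_msets n s = {M \<in> multisets_of_size ({1..s} \<times> {1..s}) n. image_mset prod.swap M = M}"

definition colour_pairs :: "nat \<Rightarrow> (nat \<Rightarrow> nat) \<Rightarrow> (nat \<Rightarrow> nat) \<Rightarrow> (nat \<times> nat) multiset" where
  "colour_pairs n \<sigma> c = image_mset (\<lambda>i. (c i, c (\<sigma> i))) (mset_set {1..n})"

lemma count_image_mset_mset_set:
  assumes "finite S"
  shows "count (image_mset f (mset_set S)) y = card {x \<in> S. f x = y}"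
proof -
  have "count (image_mset f (mset_set S)) y = (\<Sum>x\<in>{x \<in> S. f x = y}. count (mset_set S) x)"
    using assms by (simp add: count_image_mset vimage_def Int_def conj_commute)
  also have "\<dots> = (\<Sum>x\<in>{x \<in> S. f x = y}. 1)"
    using assms by (intro sum.cong) auto
  finally show ?thesis by simp
qed

lemma count_colour_pairs:
  "count (colour_pairs n \<sigma> c) (a, b) = card {i \<in> {1..n}. c i = a \<and> c (\<sigma> i) = b}"
  by (simp add: colour_pairs_def count_image_mset_mset_set)

lemma colour_pairs_in_symmetric_msets:
  assumes \<sigma>: "\<sigma> \<in> involutions n" and c: "c \<in> colourings n s (rises \<sigma>)"
  shows "colour_pairs n \<sigma> c \<in> symmetric_msets n s"
proof -
  note perm = involutionsD(1)[OF \<sigma>] and inv = involutionsD(2)[OF \<sigma>]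
  have "image_mset prod.swap (colour_pairs n \<sigma> c) = image_mset (\<lambda>i. (c (\<sigma> i), c i)) (mset_set {1..n})"
    by (simp add: colour_pairs_def image_mset.compositionality o_def)
  also have "\<dots> = image_mset (\<lambda>i. (c (\<sigma> i), c i)) (mset_set (\<sigma> ` {1..n}))"
    by (simp only: permutes_image[OF perm])
  also have "\<dots> = image_mset (\<lambda>i. (c (\<sigma> i), c i)) (image_mset \<sigma> (mset_set {1..n}))"
    by (simp only: image_mset_mset_set[OF permutes_inj_on[OF perm]])
  also have "\<dots> = colour_pairs n \<sigma> c"
    by (simp add: colour_pairs_def image_mset.compositionality o_def inv)
  finally have "image_mset prod.swap (colour_pairs n \<sigma> c) = colour_pairs n \<sigma> c" .
  moreover have "(c i, c (\<sigma> i)) \<in> {1..s} \<times> {1..s}" if "i \<in> {1..n}" for i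
    using that colouringsD(1,2)[OF c, of i] colouringsD(1,2)[OF c, of "\<sigma> i"]
      permutes_in_image[OF perm, of i] by simp
  then have "set_mset (colour_pairs n \<sigma> c) \<subseteq> {1..s} \<times> {1..s}"
    unfolding colour_pairs_def by fastforce
  moreover have "size (colour_pairs n \<sigma> c) = n"
    by (simp add: colour_pairs_def)
  ultimately show ?thesis
    unfolding symmetric_msets_def multisets_of_size_def by blast
qed

text \<open>
  Sorting by this key is sorting by the first component ascending and then by the second one
  descending, provided that the second components are at most \<open>s\<close>.
\<close>
definition lex_key :: "nat \<Rightarrow> nat \<times> nat \<Rightarrow> nat \<times> nat" where
  "lex_key s = (\<lambda>(a, b). (a, s - b))"

text \<open>
  Along \<open>1, \<dots>, n\<close> the pairs \<open>(c i, c (\<sigma> i))\<close> are sorted by \<open>lex_key\<close>, because \<open>\<sigma>\<close> is decreasing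
  on blocks. Hence the multiset of pairs determines the list of pairs, thus \<open>c\<close> and \<open>c \<circ> \<sigma>\<close>, and
  the order of the colours \<open>c (\<sigma> i)\<close> determines \<open>\<sigma>\<close>.
\<close>
lemma inj_on_colour_pairs:
  "inj_on (\<lambda>(\<sigma>, c). colour_pairs n \<sigma> c) (coloured_involutions n s)"
proof (rule inj_onI, clarify)
  fix \<sigma> c \<sigma>' c'
  assume mem: "(\<sigma>, c) \<in> coloured_involutions n s" "(\<sigma>', c') \<in> coloured_involutions n s"
    and eq: "colour_pairs n \<sigma> c = colour_pairs n \<sigma>' c'"
  have sorted_key: "sorted (map (\<lambda>i. lex_key s (d i, d (\<pi> i))) [1..<Suc n])"
    if "(\<pi>, d) \<in> coloured_involutions n s" for \<pi> d
  proof -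
    have d: "d \<in> colourings n s (rises \<pi>)" and p: "\<pi> permutes {1..n}"
      using that by (auto simp: coloured_involutions_def involutions_def)
    have "lex_key s (d i, d (\<pi> i)) \<le> lex_key s (d j, d (\<pi> j))" if "1 \<le> i" "i < j" "j \<le> n" for i j
    proof (cases "d i = d j")
      case True
      then have "\<pi> j < \<pi> i"
        by (rule decreasing_on_blocks[OF p d that])
      then have "d (\<pi> j) \<le> d (\<pi> i)"
        using that permutes_in_image[OF p, of i] permutes_in_image[OF p, of j]
        by (intro colourings_mono[OF d]) auto
      then show ?thesis using True by (auto simp: lex_key_def)
    next
      case False
      then have "d i < d j"
        using colourings_mono[OF d, of i j] that by auto
      then show ?thesis by (auto simp: lex_key_def)
    qed
    then show ?thesis
      by (simp add: sorted_iff_nth_mono_less del: upt_Suc)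
  qed
  have "mset (map (\<lambda>i. lex_key s (d i, d (\<pi> i))) [1..<Suc n]) = image_mset (lex_key s) (colour_pairs n \<pi> d)"
    for \<pi> d
    by (simp add: colour_pairs_def image_mset.compositionality o_def atLeastLessThanSuc_atLeastAtMost del: upt_Suc)
  then have "mset (map (\<lambda>i. lex_key s (c i, c (\<sigma> i))) [1..<Suc n]) =
      mset (map (\<lambda>i. lex_key s (c' i, c' (\<sigma>' i))) [1..<Suc n])"
    by (simp only: eq)
  then have "map (\<lambda>i. lex_key s (c i, c (\<sigma> i))) [1..<Suc n] = map (\<lambda>i. lex_key s (c' i, c' (\<sigma>' i))) [1..<Suc n]"
    using properties_for_sort[OF _ sorted_key[OF mem(2)]] sorted_sort_id[OF sorted_key[OF mem(1)]] by simp
  then have key: "lex_key s (c i, c (\<sigma> i)) = lex_key s (c' i, c' (\<sigma>' i))" if "i \<in> {1..n}" for i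
    using that by (auto simp del: upt_Suc)
  have \<sigma>: "\<sigma> \<in> involutions n" "c \<in> colourings n s (rises \<sigma>)"
    and \<sigma>': "\<sigma>' \<in> involutions n" "c' \<in> colourings n s (rises \<sigma>')"
    using mem by (auto simp: coloured_involutions_def)
  note p = involutionsD(1)[OF \<sigma>(1)] and p' = involutionsD(1)[OF \<sigma>'(1)]
  have eqs: "c i = c' i" "c (\<sigma> i) = c' (\<sigma>' i)" if "i \<in> {1..n}" for i
  proof -
    show "c i = c' i" using key[OF that] by (simp add: lex_key_def)
    have "c (\<sigma> i) \<le> s" "c' (\<sigma>' i) \<le> s"
      using that permutes_in_image[OF p, of i] permutes_in_image[OF p', of i]
        colouringsD(2)[OF \<sigma>(2), of "\<sigma> i"] colouringsD(2)[OF \<sigma>'(2), of "\<sigma>' i"] by auto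
    moreover have "s - c (\<sigma> i) = s - c' (\<sigma>' i)"
      using key[OF that] by (simp add: lex_key_def)
    ultimately show "c (\<sigma> i) = c' (\<sigma>' i)"
      by linarith
  qed
  have "c i = c' i" for i
    using eqs(1)[of i] colouringsD(3)[OF \<sigma>(2), of i] colouringsD(3)[OF \<sigma>'(2), of i]
    by (cases "i \<in> {1..n}") auto
  moreover have "\<sigma> = \<sigma>'"
  proof (rule permutation_determined_by_order[OF p p'])
    fix i j assume "i \<in> {1..n}" "j \<in> {1..n}"
    then show "\<sigma> i < \<sigma> j \<longleftrightarrow> \<sigma>' i < \<sigma>' j"
      using coloured_involution_less_iff[OF \<sigma>, of i j] coloured_involution_less_iff[OF \<sigma>', of i j]
        eqs(2)[of i] eqs(2)[of j] by simp
  qed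
  ultimately show "\<sigma> = \<sigma>' \<and> c = c'"
    by blast
qed

lemma ex_order_enumeration:
  fixes key :: "'a \<Rightarrow> 'b::wellorder"
  assumes "finite X" "inj_on key X"
  obtains e where "bij_betw e {1..card X} X"
    and "\<And>i j. 1 \<le> i \<Longrightarrow> i < j \<Longrightarrow> j \<le> card X \<Longrightarrow> key (e i) < key (e j)"
proof -
  obtain h where h: "bij_betw h {..<card (key ` X)} (key ` X)" "strict_mono_on {..<card (key ` X)} h"
    using ex_bij_betw_strict_mono_card[of "key ` X"] assms by blast
  have card: "card (key ` X) = card X"
    using assms card_image by blast
  define e where "e = (\<lambda>i. inv_into X key (h (i - 1)))"
  have "bij_betw (\<lambda>i. i - 1) {1..card X} {..<card X}"
    by (rule bij_betwI[where g = Suc]) auto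
  moreover have "bij_betw (inv_into X key) (key ` X) X"
    using assms by (simp add: bij_betw_inv_into inj_on_imp_bij_betw)
  ultimately have "bij_betw (inv_into X key \<circ> h \<circ> (\<lambda>i. i - 1)) {1..card X} X"
    using h(1) card by (metis bij_betw_trans)
  then have "bij_betw e {1..card X} X"
    by (simp add: e_def o_def)
  moreover have "key (e i) = h (i - 1)" if "1 \<le> i" "i \<le> card X" for i
  proof -
    have "h (i - 1) \<in> key ` X"
      using h(1) that card by (auto simp: bij_betw_def)
    then show ?thesis by (simp add: e_def f_inv_into_f)
  qed
  then have "key (e i) < key (e j)" if "1 \<le> i" "i < j" "j \<le> card X" for i j
    using that strict_mono_onD[OF h(2), of "i - 1" "j - 1"] card by simp
  ultimately show thesis by (rule that)
qed

lemma count_image_mset_swap: "count (image_mset prod.swap M) p = count M (prod.swap p)"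
  by (induction M) auto

text \<open>
  Treat the copies \<open>(p, k)\<close>, \<open>k < count M p\<close>, of the pairs in \<open>M\<close> as the points to be permuted. Swapping the pair
  and reversing the numbering of its copies is an involution \<open>\<tau>\<close> of these cells. Enumerating the cells
  by first component ascending, second component descending, copy number ascending turns \<open>\<tau>\<close>
  into an involution of \<open>{1..n}\<close>. The reversal of the numbering is what makes this involution
  decreasing on blocks, including among copies of one pair.
\<close>
lemma surj_colour_pairs:
  assumes "M \<in> symmetric_msets n s"
  shows "M \<in> (\<lambda>(\<sigma>, c). colour_pairs n \<sigma> c) ` coloured_involutions n s"
proof -
  have M: "set_mset M \<subseteq> {1..s} \<times> {1..s}" "size M = n" and swap: "image_mset prod.swap M = M"
    using assms by (auto simp: symmetric_msets_def multisets_of_size_def)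
  have count_swap: "count M (prod.swap p) = count M p" for p
    using count_image_mset_swap[of M p] by (simp add: swap)
  \<comment> \<open>the cells, one for each copy of a pair in \<open>M\<close>\<close>
  define X where "X = (SIGMA p:set_mset M. {..<count M p})"
  have X_iff: "(p, k) \<in> X \<longleftrightarrow> k < count M p" for p k
    by (auto simp: X_def simp flip: count_greater_zero_iff)
  have X_le: "a \<in> {1..s} \<and> b \<in> {1..s}" if "((a, b), k) \<in> X" for a b k
    using that M(1) by (auto simp: X_def)
  have "finite X"
    by (simp add: X_def)
  have card_X: "card X = n"
    using M(2) by (simp add: X_def size_multiset_overloaded_eq)
  define key where "key = (\<lambda>(p, k :: nat). (lex_key s p, k))"
  have "inj_on key X"
    by (rule inj_onI) (auto simp: key_def lex_key_def dest!: X_le)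
  then obtain e where e: "bij_betw e {1..n} X"
    and e_mono: "\<And>i j. 1 \<le> i \<Longrightarrow> i < j \<Longrightarrow> j \<le> n \<Longrightarrow> key (e i) < key (e j)"
    using ex_order_enumeration[OF \<open>finite X\<close>] card_X by metis
  have e_in: "e i \<in> X" if "i \<in> {1..n}" for i
    using bij_betwE[OF e] that by blast
  have e_less: "i < j" if "key (e i) < key (e j)" "i \<in> {1..n}" "j \<in> {1..n}" for i j
    using that e_mono[of j i] by (cases i j rule: linorder_cases) auto
  define \<tau> where "\<tau> = (\<lambda>(p, k). (prod.swap p, count M p - 1 - k))"
  have \<tau>_in: "\<tau> x \<in> X" and \<tau>_\<tau>: "\<tau> (\<tau> x) = x" if "x \<in> X" for x
  proof -
    obtain p k where "x = (p, k)"
      by (cases x)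
    then show "\<tau> x \<in> X" "\<tau> (\<tau> x) = x"
      using that by (auto simp: \<tau>_def X_iff count_swap)
  qed
  define \<sigma> where "\<sigma> = (\<lambda>i. if i \<in> {1..n} then inv_into {1..n} e (\<tau> (e i)) else i)"
  have \<sigma>_in: "\<sigma> i \<in> {1..n}" and e_\<sigma>: "e (\<sigma> i) = \<tau> (e i)" if "i \<in> {1..n}" for i
  proof -
    have "\<tau> (e i) \<in> e ` {1..n}"
      using \<tau>_in[OF e_in[OF that]] e by (simp add: bij_betw_def)
    then show "\<sigma> i \<in> {1..n}" "e (\<sigma> i) = \<tau> (e i)"
      using that by (simp_all only: \<sigma>_def if_True inv_into_into f_inv_into_f)
  qed
  have inv: "\<sigma> (\<sigma> i) = i" for i
  proof (cases "i \<in> {1..n}")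
    case True
    then have "e (\<sigma> (\<sigma> i)) = e i"
      by (simp only: e_\<sigma> \<sigma>_in e_in \<tau>_\<tau>)
    then show ?thesis
      using e True \<sigma>_in by (meson bij_betw_def inj_onD)
  next
    case False
    then have "\<sigma> i = i"
      by (simp only: \<sigma>_def if_False)
    then show ?thesis by simp
  qed
  have perm: "\<sigma> permutes {1..n}"
    unfolding permutes_def
  proof (intro conjI allI impI)
    show "\<exists>!x. \<sigma> x = y" for y
      using inv by metis
    show "\<sigma> i = i" if "i \<notin> {1..n}" for i
      using that by (simp only: \<sigma>_def if_False)
  qed
  then have \<sigma>: "\<sigma> \<in> involutions n"
    using inv by (auto simp: involutions_def)
  define c where "c = (\<lambda>i. if i \<in> {1..n} then fst (fst (e i)) else 0)"
  have c_in: "c i \<in> {1..s}" if "i \<in> {1..n}" for i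
    using X_le[of "fst (fst (e i))" "snd (fst (e i))" "snd (e i)"] e_in[OF that] that by (simp add: c_def)
  have c: "c \<in> colourings n s (rises \<sigma>)"
  proof (rule colouringsI)
    show "1 \<le> c i \<and> c i \<le> s" if "1 \<le> i" "i \<le> n" for i
      using c_in[of i] that by simp
    show "c i = 0" if "i < 1 \<or> n < i" for i
      using that by (auto simp: c_def)
    show "c i + of_bool (i \<in> rises \<sigma>) \<le> c (Suc i)" if i: "1 \<le> i" "i < n" for i
    proof -
      have i_in: "i \<in> {1..n}" "Suc i \<in> {1..n}"
        using i by auto
      obtain a b k where x: "e i = ((a, b), k)"
        by (metis prod.exhaust)
      obtain a' b' k' where y: "e (Suc i) = ((a', b'), k')"
        by (metis prod.exhaust)
      have xy: "((a, b), k) \<in> X" "((a', b'), k') \<in> X"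
        using e_in[OF i_in(1)] e_in[OF i_in(2)] x y by simp_all
      have less: "key ((a, b), k) < key ((a', b'), k')"
        using e_mono[of i "Suc i"] i x y by simp
      have cs: "c i = a" "c (Suc i) = a'"
        using i_in x y by (simp_all add: c_def)
      have "\<sigma> (Suc i) < \<sigma> i" if "a = a'"
      proof (rule e_less)
        have "b' < b \<or> b' = b \<and> k < k'"
          using less that X_le[OF xy(1)] X_le[OF xy(2)] by (auto simp: key_def lex_key_def)
        then have "key (\<tau> ((a', b'), k')) < key (\<tau> ((a, b), k))"
          using xy that by (auto simp: key_def lex_key_def \<tau>_def X_iff)
        then show "key (e (\<sigma> (Suc i))) < key (e (\<sigma> i))"
          using e_\<sigma>[OF i_in(1)] e_\<sigma>[OF i_in(2)] x y by simp
      qed (use i_in \<sigma>_in in blast)+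
      then have "i \<notin> rises \<sigma>" if "a = a'"
        using that by (auto simp: rises_def)
      moreover have "a \<le> a'"
        using less by (auto simp: key_def lex_key_def)
      ultimately show ?thesis
        unfolding cs by (cases "a = a'") auto
    qed
  qed
  have "colour_pairs n \<sigma> c = image_mset (\<lambda>i. fst (e i)) (mset_set {1..n})"
    unfolding colour_pairs_def
  proof (rule image_mset_cong)
    fix i assume "i \<in># mset_set {1..n}"
    then have i: "i \<in> {1..n}" by simp
    then show "(c i, c (\<sigma> i)) = fst (e i)"
      using e_\<sigma>[OF i] \<sigma>_in[OF i] by (simp add: c_def \<tau>_def split_beta)
  qed
  also have "\<dots> = image_mset fst (image_mset e (mset_set {1..n}))"
    by (simp add: image_mset.compositionality o_def)
  also have "image_mset e (mset_set {1..n}) = mset_set X"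
    using e by (simp add: image_mset_mset_set bij_betw_def)
  also have "image_mset fst (mset_set X) = M"
  proof (rule multiset_eqI)
    fix p
    have "{x \<in> X. fst x = p} = {p} \<times> {..<count M p}"
      by (auto simp: X_iff)
    then show "count (image_mset fst (mset_set X)) p = count M p"
      using \<open>finite X\<close> by (simp add: count_image_mset_mset_set)
  qed
  finally show ?thesis
    using \<sigma> c by (force simp: coloured_involutions_def)
qed

lemma bij_betw_colour_pairs:
  "bij_betw (\<lambda>(\<sigma>, c). colour_pairs n \<sigma> c) (coloured_involutions n s) (symmetric_msets n s)"
  unfolding bij_betw_def
  using inj_on_colour_pairs colour_pairs_in_symmetric_msets surj_colour_pairs
  by (fastforce simp: coloured_involutions_def)

section \<open>The sign as a function of the matrix\<close>

text \<open>
  Splitting off one transposition \<open>a \<leftrightarrow> \<sigma> a\<close> at a time shows that \<open>\<sigma>\<close> is a product of \<open>m\<close>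
  transpositions.
\<close>
lemma sign_involution:
  fixes \<sigma> :: "'a \<Rightarrow> 'a"
  assumes "finite {i. \<sigma> i \<noteq> i}" "\<And>i. \<sigma> (\<sigma> i) = i" "card {i. \<sigma> i \<noteq> i} = 2 * m"
  shows "sign \<sigma> = (- 1) ^ m"
  using assms
proof (induction m arbitrary: \<sigma>)
  case 0
  then have "\<sigma> = id" by auto
  then show ?case by (simp only: sign_id power_0)
next
  case (Suc m)
  note inv = Suc.prems(2)
  obtain a where a: "\<sigma> a \<noteq> a"
    using Suc.prems(3) by (metis (mono_tags) Collect_empty_eq card.empty mult_eq_0_iff nat.simps(3) zero_neq_numeral)
  define \<rho> where "\<rho> = transpose a (\<sigma> a) \<circ> \<sigma>"
  have \<rho>: "\<rho> i = (if i = a \<or> i = \<sigma> a then i else \<sigma> i)" for i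
    using inv by (auto simp: \<rho>_def transpose_def) metis+
  have supp: "{i. \<rho> i \<noteq> i} = {i. \<sigma> i \<noteq> i} - {a, \<sigma> a}"
    by (auto simp: \<rho>)
  have "\<rho> (\<rho> i) = i" for i
    using inv by (auto simp: \<rho>) metis+
  moreover have "card {i. \<rho> i \<noteq> i} = 2 * m"
    using Suc.prems(1,3) a inv[of a] by (simp add: supp card_Diff_subset)
  moreover have "finite {i. \<rho> i \<noteq> i}"
    using Suc.prems(1) by (simp add: supp)
  ultimately have "sign \<rho> = (- 1) ^ m"
    by (intro Suc.IH) auto
  moreover have "\<sigma> = transpose a (\<sigma> a) \<circ> \<rho>"
    by (simp add: \<rho>_def fun_eq_iff)
  moreover have "permutation \<rho>"
    using \<open>finite {i. \<rho> i \<noteq> i}\<close> \<open>\<And>i. \<rho> (\<rho> i) = i\<close> by (simp add: permutation involuntory_imp_bij)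
  ultimately show ?case
    using a by (metis permutation_swap_id power_Suc sign_compose sign_swap_id)
qed

text \<open>
  The involution exchanges the points that it moves up with those that it moves down.
\<close>
lemma even_card_nonfixed:
  fixes \<sigma> :: "nat \<Rightarrow> nat"
  assumes "finite S" "\<And>i. \<sigma> (\<sigma> i) = i" "\<And>i. i \<in> S \<Longrightarrow> \<sigma> i \<in> S"
  shows "even (card {i \<in> S. \<sigma> i \<noteq> i})"
proof -
  have "bij_betw \<sigma> {i \<in> S. i < \<sigma> i} {i \<in> S. \<sigma> i < i}"
    by (rule bij_betwI[where g = \<sigma>]) (use assms in auto)
  then have "card {i \<in> S. i < \<sigma> i} = card {i \<in> S. \<sigma> i < i}"
    by (rule bij_betw_same_card)
  moreover have "card {i \<in> S. \<sigma> i \<noteq> i} = card {i \<in> S. i < \<sigma> i} + card {i \<in> S. \<sigma> i < i}"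
    using assms(1) by (subst card_Un_disjoint[symmetric]) (auto intro!: arg_cong[where f = card])
  ultimately show ?thesis by simp
qed

definition odd_diagonal :: "(nat \<times> nat) multiset \<Rightarrow> nat set" where
  "odd_diagonal M = {a. odd (count M (a, a))}"

text \<open>
  A function that is decreasing on a block has at most one fixed point there. The points of
  colour \<open>a\<close> whose image has colour \<open>a\<close> are permuted by \<open>\<sigma>\<close>, so their number \<open>count M (a, a)\<close> is odd
  exactly when this fixed point exists.
\<close>
lemma card_fixed_points:
  assumes \<sigma>: "\<sigma> \<in> involutions n" and c: "c \<in> colourings n s (rises \<sigma>)"
  shows "card {i \<in> {1..n}. \<sigma> i = i} = card (odd_diagonal (colour_pairs n \<sigma> c))"
proof -
  note perm = involutionsD(1)[OF \<sigma>] and inv = involutionsD(2)[OF \<sigma>]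
  have less: "c i \<noteq> c j" if "i \<in> {1..n}" "j \<in> {1..n}" "\<sigma> i = i" "\<sigma> j = j" "i < j" for i j
    using decreasing_on_blocks[OF perm c, of i j] that by auto
  have inj: "inj_on c {i \<in> {1..n}. \<sigma> i = i}"
  proof (rule inj_onI)
    fix i j assume "i \<in> {i \<in> {1..n}. \<sigma> i = i}" "j \<in> {i \<in> {1..n}. \<sigma> i = i}" "c i = c j"
    then show "i = j"
      using less[of i j] less[of j i] by (cases i j rule: linorder_cases) auto
  qed
  have "odd (count (colour_pairs n \<sigma> c) (a, a)) \<longleftrightarrow> a \<in> c ` {i \<in> {1..n}. \<sigma> i = i}" for a
  proof -
    let ?S = "{i \<in> {1..n}. c i = a \<and> c (\<sigma> i) = a}"
    have "card ?S = card {i \<in> ?S. \<sigma> i \<noteq> i} + card {i \<in> ?S. \<sigma> i = i}"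
      by (subst card_Un_disjoint[symmetric]) (auto intro!: arg_cong[where f = card])
    moreover have "even (card {i \<in> ?S. \<sigma> i \<noteq> i})"
      using permutes_in_image[OF perm] by (intro even_card_nonfixed) (auto simp: inv simp del: atLeastAtMost_iff)
    ultimately have "odd (count (colour_pairs n \<sigma> c) (a, a)) \<longleftrightarrow> odd (card {i \<in> ?S. \<sigma> i = i})"
      by (simp add: count_colour_pairs)
    also have "{i \<in> ?S. \<sigma> i = i} = {i \<in> {i \<in> {1..n}. \<sigma> i = i}. c i = a}"
      by auto
    also have "odd (card \<dots>) \<longleftrightarrow> a \<in> c ` {i \<in> {1..n}. \<sigma> i = i}"
    proof (cases "a \<in> c ` {i \<in> {1..n}. \<sigma> i = i}")
      case True
      then obtain j where "j \<in> {i \<in> {1..n}. \<sigma> i = i}" "c j = a" by blast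
      then have "{i \<in> {i \<in> {1..n}. \<sigma> i = i}. c i = a} = {j}"
        using inj by (auto dest: inj_onD)
      then show ?thesis using True by simp
    next
      case False
      then have "{i \<in> {i \<in> {1..n}. \<sigma> i = i}. c i = a} = {}" by blast
      then show ?thesis using False by (simp only: card.empty) simp
    qed
    finally show ?thesis .
  qed
  then have "odd_diagonal (colour_pairs n \<sigma> c) = c ` {i \<in> {1..n}. \<sigma> i = i}"
    by (auto simp: odd_diagonal_def)
  then show ?thesis
    using card_image[OF inj] by simp
qed

lemma sign_eq_odd_diagonal:
  assumes \<sigma>: "\<sigma> \<in> involutions n" and c: "c \<in> colourings n s (rises \<sigma>)"
  shows "sign \<sigma> = (- 1) ^ ((n - card (odd_diagonal (colour_pairs n \<sigma> c))) div 2)"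
proof (rule sign_involution)
  note perm = involutionsD(1)[OF \<sigma>] and inv = involutionsD(2)[OF \<sigma>]
  have supp: "{i. \<sigma> i \<noteq> i} = {i \<in> {1..n}. \<sigma> i \<noteq> i}"
    using perm by (auto simp: permutes_def)
  show "finite {i. \<sigma> i \<noteq> i}"
    unfolding supp by simp
  have "even (card {i. \<sigma> i \<noteq> i})"
    unfolding supp using permutes_in_image[OF perm]
    by (intro even_card_nonfixed) (auto simp: inv simp del: atLeastAtMost_iff)
  moreover have "card {i. \<sigma> i \<noteq> i} = n - card (odd_diagonal (colour_pairs n \<sigma> c))"
  proof -
    have "{i. \<sigma> i \<noteq> i} = {1..n} - {i \<in> {1..n}. \<sigma> i = i}"
      unfolding supp by auto
    also have "card \<dots> = card {1..n} - card {i \<in> {1..n}. \<sigma> i = i}"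
      by (intro card_Diff_subset) auto
    finally show ?thesis
      using card_fixed_points[OF \<sigma> c] by simp
  qed
  ultimately show "card {i. \<sigma> i \<noteq> i} = 2 * ((n - card (odd_diagonal (colour_pairs n \<sigma> c))) div 2)"
    by simp
  show "\<sigma> (\<sigma> i) = i" for i
    by (rule inv)
qed

section \<open>Counting symmetric matrices with sign\<close>

definition pairs_upto :: "nat \<Rightarrow> (nat \<times> nat) set" where
  "pairs_upto s = {(a, b). 1 \<le> a \<and> a \<le> b \<and> b \<le> s}"

lemma finite_pairs_upto: "finite (pairs_upto s)"
  by (rule finite_subset[of _ "{1..s} \<times> {1..s}"]) (auto simp: pairs_upto_def)

lemma card_pairs_upto: "card (pairs_upto s) = (s + 1) choose 2"
proof (induction s)
  case 0
  have "pairs_upto 0 = {}"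
    by (auto simp: pairs_upto_def)
  then show ?case by simp
next
  case (Suc s)
  have "pairs_upto (Suc s) = pairs_upto s \<union> {1..Suc s} \<times> {Suc s}"
    by (auto simp: pairs_upto_def)
  moreover have "pairs_upto s \<inter> {1..Suc s} \<times> {Suc s} = {}"
    by (auto simp: pairs_upto_def)
  ultimately have "card (pairs_upto (Suc s)) = card (pairs_upto s) + Suc s"
    using finite_pairs_upto by (simp add: card_Un_disjoint)
  then show ?case
    using Suc.IH by (simp add: numeral_2_eq_2)
qed

text \<open>
  In a symmetric matrix, the entries above the diagonal and the halves of the diagonal entries,
  rounded down, form \<open>N\<close>; the parities of the diagonal entries form \<open>D\<close>. This function rebuilds the matrix.
\<close>
definition symmetrize :: "(nat \<times> nat) multiset \<Rightarrow> nat set \<Rightarrow> (nat \<times> nat) multiset" where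
  "symmetrize N D = N + image_mset prod.swap N + image_mset (\<lambda>a. (a, a)) (mset_set D)"

lemma count_symmetrize:
  assumes "finite D"
  shows "count (symmetrize N D) (a, b) = count N (a, b) + count N (b, a) + of_bool (a = b \<and> a \<in> D)"
proof -
  have "{x \<in> D. (x, x) = (a, b)} = (if a = b \<and> a \<in> D then {a} else {})"
    by auto
  then show ?thesis
    using assms by (simp add: symmetrize_def count_image_mset_swap count_image_mset_mset_set)
qed

lemma odd_diagonal_symmetrize:
  assumes "finite D"
  shows "odd_diagonal (symmetrize N D) = D"
  using assms by (auto simp: odd_diagonal_def count_symmetrize)

lemma size_symmetrize:
  assumes "finite D"
  shows "size (symmetrize N D) = 2 * size N + card D"
  using assms by (simp add: symmetrize_def)

lemma symmetrize_in_symmetric_msets: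
  assumes "set_mset N \<subseteq> pairs_upto s" "D \<subseteq> {1..s}" "2 * size N + card D = n"
  shows "symmetrize N D \<in> symmetric_msets n s"
proof -
  have D: "finite D"
    using assms(2) finite_subset by blast
  have "image_mset prod.swap (symmetrize N D) = symmetrize N D"
    by (rule multiset_eqI) (use D in \<open>auto simp: count_image_mset_swap count_symmetrize\<close>)
  moreover have "set_mset (symmetrize N D) \<subseteq> {1..s} \<times> {1..s}"
    using assms(1,2) D by (fastforce simp: symmetrize_def pairs_upto_def)
  ultimately show ?thesis
    using assms(3) D by (simp add: symmetric_msets_def multisets_of_size_def size_symmetrize)
qed

lemma count_mset_pairs_upto:
  assumes "set_mset N \<subseteq> pairs_upto s" "b < a"
  shows "count N (a, b) = 0"
  using assms by (auto simp: pairs_upto_def count_eq_zero_iff)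

lemma symmetrize_inj:
  assumes N: "set_mset N \<subseteq> pairs_upto s" "set_mset N' \<subseteq> pairs_upto s"
    and D: "finite D" "finite D'"
    and eq: "symmetrize N D = symmetrize N' D'"
  shows "N = N' \<and> D = D'"
proof
  show DD: "D = D'"
    using odd_diagonal_symmetrize[OF D(1), of N] odd_diagonal_symmetrize[OF D(2), of N'] eq by simp
  show "N = N'"
  proof (rule multiset_eqI, clarify)
    fix a b
    have *: "count N (a, b) + count N (b, a) = count N' (a, b) + count N' (b, a)"
      using arg_cong[OF eq, of "\<lambda>M. count M (a, b)"] D DD by (simp add: count_symmetrize)
    show "count N (a, b) = count N' (a, b)"
      using * count_mset_pairs_upto[OF N(1)] count_mset_pairs_upto[OF N(2)]
      by (cases a b rule: linorder_cases) simp_all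
  qed
qed

lemma symmetrize_surj:
  assumes "M \<in> symmetric_msets n s"
  obtains N D where "set_mset N \<subseteq> pairs_upto s" "D \<subseteq> {1..s}" "symmetrize N D = M"
proof -
  have M: "set_mset M \<subseteq> {1..s} \<times> {1..s}" and swap: "image_mset prod.swap M = M"
    using assms by (auto simp: symmetric_msets_def multisets_of_size_def)
  have count_swap: "count M (b, a) = count M (a, b)" for a b
    using count_image_mset_swap[of M "(b, a)"] by (simp add: swap)
  have outside: "count M (a, b) = 0" if "a \<notin> {1..s} \<or> b \<notin> {1..s}" for a b
    using M that by (force simp: count_eq_zero_iff)
  define h where "h = (\<lambda>(a, b). if a = b then count M (a, b) div 2 else count M (a, b))"
  define N where "N = (\<Sum>p\<in>pairs_upto s. replicate_mset (h p) p)"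
  have count_N: "count N p = (if p \<in> pairs_upto s then h p else 0)" for p
    using finite_pairs_upto by (simp add: N_def count_sum)
  have N: "set_mset N \<subseteq> pairs_upto s"
    by (auto simp: count_N simp flip: count_greater_zero_iff split: if_splits)
  have D: "odd_diagonal M \<subseteq> {1..s}"
    unfolding odd_diagonal_def using outside by (metis (mono_tags, lifting) even_zero mem_Collect_eq subsetI)
  then have fin: "finite (odd_diagonal M)"
    by (rule finite_subset) simp
  have "symmetrize N (odd_diagonal M) = M"
  proof (rule multiset_eqI, clarify)
    fix a b
    show "count (symmetrize N (odd_diagonal M)) (a, b) = count M (a, b)"
    proof (cases "a \<in> {1..s} \<and> b \<in> {1..s}")
      case True
      then show ?thesis
        using fin count_swap[of a b]
        by (cases a b rule: linorder_cases)
          (auto simp: count_symmetrize count_N h_def pairs_upto_def odd_diagonal_def elim!: oddE)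
    next
      case False
      then show ?thesis
        using fin outside[of a b]
        by (auto simp: count_symmetrize count_N pairs_upto_def odd_diagonal_def)
    qed
  qed
  then show thesis
    using that N D by blast
qed

text \<open>
  Listing \<open>j = size N\<close> as a separate component makes the sum over the parts an iterated sum over \<open>j\<close>.
\<close>
definition symmetric_parts :: "nat \<Rightarrow> nat \<Rightarrow> (nat \<times> (nat \<times> nat) multiset \<times> nat set) set" where
  "symmetric_parts n s = (SIGMA j:{0..n div 2}.
     multisets_of_size (pairs_upto s) j \<times> {D. D \<subseteq> {1..s} \<and> card D = n - 2 * j})"

lemma bij_betw_symmetrize:
  "bij_betw (\<lambda>(j, N, D). symmetrize N D) (symmetric_parts n s) (symmetric_msets n s)"
  unfolding bij_betw_def
proof
  show "inj_on (\<lambda>(j, N, D). symmetrize N D) (symmetric_parts n s)"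
  proof (rule inj_onI)
    fix x y
    assume xy: "x \<in> symmetric_parts n s" "y \<in> symmetric_parts n s"
      and sym: "(case x of (j, N, D) \<Rightarrow> symmetrize N D) = (case y of (j, N, D) \<Rightarrow> symmetrize N D)"
    obtain j N D where x: "x = (j, N, D)"
      by (metis prod.exhaust)
    obtain j' N' D' where y: "y = (j', N', D')"
      by (metis prod.exhaust)
    have mem: "(j, N, D) \<in> symmetric_parts n s" "(j', N', D') \<in> symmetric_parts n s"
      and eq: "symmetrize N D = symmetrize N' D'"
      using xy sym by (simp_all add: x y)
    have "finite D" "finite D'"
      using mem by (auto simp: symmetric_parts_def intro: finite_subset)
    then have "N = N' \<and> D = D'"
      using mem eq by (intro symmetrize_inj[of N s N']) (auto simp: symmetric_parts_def multisets_of_size_def)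
    then show "x = y"
      using mem unfolding x y by (auto simp: symmetric_parts_def multisets_of_size_def)
  qed
  show "(\<lambda>(j, N, D). symmetrize N D) ` symmetric_parts n s = symmetric_msets n s"
  proof (intro equalityI subsetI)
    fix M assume "M \<in> (\<lambda>(j, N, D). symmetrize N D) ` symmetric_parts n s"
    then show "M \<in> symmetric_msets n s"
      by (auto simp: symmetric_parts_def multisets_of_size_def intro!: symmetrize_in_symmetric_msets)
  next
    fix M assume M: "M \<in> symmetric_msets n s"
    then obtain N D where ND: "set_mset N \<subseteq> pairs_upto s" "D \<subseteq> {1..s}" "symmetrize N D = M"
      by (rule symmetrize_surj)
    have "finite D"
      using ND(2) finite_subset by blast
    then have "n = 2 * size N + card D"
      using size_symmetrize[of D N] ND(3) M by (simp add: symmetric_msets_def multisets_of_size_def)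
    then have "(size N, N, D) \<in> symmetric_parts n s"
      using ND by (auto simp: symmetric_parts_def multisets_of_size_def)
    then show "M \<in> (\<lambda>(j, N, D). symmetrize N D) ` symmetric_parts n s"
      using ND(3) by force
  qed
qed

text \<open>
  If \<open>M\<close> has parts \<open>N\<close> and \<open>D\<close> then \<open>n = 2 * size N + card D\<close>, so the weight of \<open>M\<close> is \<open>(- 1) ^ size N\<close>, and
  the parts can be chosen independently once \<open>size N\<close> is fixed.
\<close>
lemma sum_symmetric_msets:
  "(\<Sum>M\<in>symmetric_msets n s. (- 1) ^ ((n - card (odd_diagonal M)) div 2) :: int) =
    (\<Sum>j = 0..n div 2.
      (- 1) ^ j * int ((((s + 1) choose 2) + j - 1) choose j) * int (s choose (n - 2 * j)))"
proof -
  let ?D = "\<lambda>j. {D. D \<subseteq> {1..s} \<and> card D = n - 2 * j}"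
  have "(\<Sum>M\<in>symmetric_msets n s. (- 1) ^ ((n - card (odd_diagonal M)) div 2) :: int) =
      (\<Sum>(j, N, D)\<in>symmetric_parts n s. (- 1) ^ ((n - card (odd_diagonal (symmetrize N D))) div 2))"
    by (simp add: sum.reindex_bij_betw[OF bij_betw_symmetrize, symmetric] split_def)
  also have "\<dots> = (\<Sum>(j, N, D)\<in>symmetric_parts n s. (- 1) ^ j)"
  proof (rule sum.cong)
    fix x assume "x \<in> symmetric_parts n s"
    then obtain j N D where x: "x = (j, N, D)" "j \<le> n div 2" "D \<subseteq> {1..s}" "card D = n - 2 * j"
      by (auto simp: symmetric_parts_def)
    have "finite D"
      using x(3) finite_subset by blast
    moreover have "(n - (n - 2 * j)) div 2 = j"
      using x(2) by simp
    ultimately show "(case x of (j, N, D) \<Rightarrow> (- 1) ^ ((n - card (odd_diagonal (symmetrize N D))) div 2)) =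
        (case x of (j, N, D) \<Rightarrow> (- 1 :: int) ^ j)"
      by (simp add: x(1,4) odd_diagonal_symmetrize)
  qed simp
  also have "\<dots> = (\<Sum>j = 0..n div 2. \<Sum>x\<in>multisets_of_size (pairs_upto s) j \<times> ?D j. (- 1) ^ j)"
    unfolding symmetric_parts_def
    by (subst sum.Sigma)
      (auto simp: finite_pairs_upto split_def intro!: finite_cartesian_product finite_multisets_of_size)
  also have "\<dots> = (\<Sum>j = 0..n div 2.
      (- 1) ^ j * int ((((s + 1) choose 2) + j - 1) choose j) * int (s choose (n - 2 * j)))"
    using n_subsets[of "{1..s}"] finite_pairs_upto
    by (simp add: card_cartesian_product card_multisets_of_size card_pairs_upto mult_ac)
  finally show ?thesis .
qed

theorem mainTheorem2:
  fixes n s :: nat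
  assumes "n \<ge> 1" and "s \<ge> 1"
  shows "(\<Sum>j = 0..s - 1. int ((n + j) choose j) * signed_eulerian_inv n (s - j - 1)) =
    (\<Sum>j = 0..n div 2.
      (- 1) ^ j * int ((((s + 1) choose 2) + j - 1) choose j) * int (s choose (n - 2 * j)))"
proof -
  have "(\<Sum>j = 0..s - 1. int ((n + j) choose j) * signed_eulerian_inv n (s - j - 1)) =
      (\<Sum>(\<sigma>, c)\<in>coloured_involutions n s. sign \<sigma>)"
    by (rule sum_coeffs_eq_sum_coloured_involutions[OF assms])
  also have "\<dots> = (\<Sum>x\<in>coloured_involutions n s.
      (- 1) ^ ((n - card (odd_diagonal (case x of (\<sigma>, c) \<Rightarrow> colour_pairs n \<sigma> c))) div 2))"
    by (rule sum.cong) (auto simp: coloured_involutions_def sign_eq_odd_diagonal)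
  also have "\<dots> = (\<Sum>M\<in>symmetric_msets n s. (- 1) ^ ((n - card (odd_diagonal M)) div 2))"
    by (rule sum.reindex_bij_betw[OF bij_betw_colour_pairs])
  also note sum_symmetric_msets
  finally show ?thesis .
qed

end
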